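(* Let $d\in\mathbb{N}$, let $f:\mathbb{C}^d\times\mathbb{C}^d\to\mathbb{C}^d$, $(x,y)\mapsto f(x,y)$, be sufficiently smooth, and consider for $\tau\in\mathbb{R}$ the delay differential equation $$u'(t)=f(u(t),u(t-\tau)),\qquad t\in\mathbb{R}.$$ Let $\tilde u$ be a periodic solution of this equation at $\tau=\tilde\tau$ with period $T$. Suppose further that $\tilde u$ (as a $T$-periodic solution at $\tau=\tilde\tau$) possesses a Floquet multiplier $\mu\in\mathbb{C}$ such that $\mu^j=1$ for some $j\in\{2,3,\ldots\}$ and $\mu^l\neq 1$ for all $l=1,2,\ldots,j-1$. Then, for every $k\in\mathbb{Z}$, $\tilde u$ is a periodic solution (with period $T$) of the equation $u'(t)=f(u(t),u(t-\tau))$ at $\tau=\tilde\tau+jkT$, and $\mu$ is a Floquet multiplier of $\tilde u$ at $\tau=\tilde\tau+jkT$.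
   Context: The delay (time-shift) parameter $\tau$ is allowed to be any real number, including negative values. A solution on $\mathbb{R}$ is a differentiable function $u:\mathbb{R}\to\mathbb{C}^d$ satisfying the equation for all $t\in\mathbb{R}$. "Sufficiently smooth" means in particular that the partial derivatives $\partial_x f$, $\partial_y f$ with respect to the first and second argument (complex $d\times d$ matrix-valued functions) exist and are continuous. Floquet multiplier: Let $\tilde u$ be a periodic solution with period $T$ (so $T>0$ and $\tilde u(t+T)=\tilde u(t)$ for all $t\in\mathbb{R}$) of $u'(t)=f(u(t),u(t-\tau))$ at a given value of $\tau$. Define the $T$-periodic matrix functions $A,B:\mathbb{R}\to\mathbb{C}^{d\times d}$ by $$A(t)=\partial_x f(\tilde u(t),\tilde u(t-\tau)),\qquad B(t)=\partial_y f(\tilde u(t),\tilde u(t-\tau)).$$ A number $\mu\in\mathbb{C}$ is a Floquet multiplier of $\tilde u$ at $\tau$ if there is a not identically zero (differentiable) eigenfunction $w\in C(\mathbb{R},\mathbb{C}^d)$ such that for all $t\in\mathbb{R}$ $$\dot w(t)=A(t)w(t)+B(t)w(t-\tau),\qquad \mu\, w(t)=w(t+T).$$ *)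

theory Defs
  imports "HOL-Analysis.Analysis"
begin

text \<open>
  The matrices of the partial derivatives of \<open>f\<close> with respect to the first and the second
  argument. Here \<^const>\<open>frechet_derivative\<close> is a real derivative, and \<^const>\<open>matrix\<close>
  reads off its values on the complex standard basis vectors, so \<open>partial_x\<close> and
  \<open>partial_y\<close> represent the derivative only where that derivative is complex linear;
  \<open>smooth_rhs\<close> below demands this.
\<close>

definition partial_x ::
  "((complex ^ 'd) \<times> (complex ^ 'd) \<Rightarrow> complex ^ 'd) \<Rightarrow>
   (complex ^ 'd) \<times> (complex ^ 'd) \<Rightarrow> complex ^ 'd ^ 'd" where
  "partial_x f p = matrix (frechet_derivative (\<lambda>x. f (x, snd p)) (at (fst p)))"

definition partial_y ::
  "((complex ^ 'd) \<times> (complex ^ 'd) \<Rightarrow> complex ^ 'd) \<Rightarrow>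
   (complex ^ 'd) \<times> (complex ^ 'd) \<Rightarrow> complex ^ 'd ^ 'd" where
  "partial_y f p = matrix (frechet_derivative (\<lambda>y. f (fst p, y)) (at (snd p)))"

definition smooth_rhs ::
  "((complex ^ 'd) \<times> (complex ^ 'd) \<Rightarrow> complex ^ 'd) \<Rightarrow> bool" where
  "smooth_rhs f \<longleftrightarrow>
     (\<forall>x y. ((\<lambda>x'. f (x', y)) has_derivative (\<lambda>h. partial_x f (x, y) *v h)) (at x)) \<and>
     (\<forall>x y. ((\<lambda>y'. f (x, y')) has_derivative (\<lambda>h. partial_y f (x, y) *v h)) (at y)) \<and>
     continuous_on UNIV (partial_x f) \<and>
     continuous_on UNIV (partial_y f)"

definition dde_solution ::
  "((complex ^ 'd) \<times> (complex ^ 'd) \<Rightarrow> complex ^ 'd) \<Rightarrow> real \<Rightarrow> (real \<Rightarrow> complex ^ 'd) \<Rightarrow> bool"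
  where
  "dde_solution f \<tau> u \<longleftrightarrow>
     (\<forall>t. (u has_vector_derivative f (u t, u (t - \<tau>))) (at t))"

text \<open>The period \<open>T\<close> need not be minimal.\<close>

definition periodic_solution ::
  "((complex ^ 'd) \<times> (complex ^ 'd) \<Rightarrow> complex ^ 'd) \<Rightarrow> real \<Rightarrow> real \<Rightarrow>
   (real \<Rightarrow> complex ^ 'd) \<Rightarrow> bool" where
  "periodic_solution f \<tau> T u \<longleftrightarrow>
     dde_solution f \<tau> u \<and> T > 0 \<and> (\<forall>t. u (t + T) = u t)"

definition floquet_multiplier ::
  "((complex ^ 'd) \<times> (complex ^ 'd) \<Rightarrow> complex ^ 'd) \<Rightarrow> real \<Rightarrow> real \<Rightarrow>
   (real \<Rightarrow> complex ^ 'd) \<Rightarrow> complex \<Rightarrow> bool" where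
  "floquet_multiplier f \<tau> T u \<mu> \<longleftrightarrow>
     (let A = (\<lambda>t. partial_x f (u t, u (t - \<tau>)));
          B = (\<lambda>t. partial_y f (u t, u (t - \<tau>)))
      in \<exists>w :: real \<Rightarrow> complex ^ 'd.
           continuous_on UNIV w \<and>
           (\<exists>t. w t \<noteq> 0) \<and>
           (\<forall>t. (w has_vector_derivative (A t *v w t + B t *v w (t - \<tau>))) (at t)) \<and>
           (\<forall>t. \<mu> *s w t = w (t + T)))"

end

theory Submission
  imports Defs "HOL-Library.Periodic_Fun"
begin

text \<open>The delay changes by an integer multiple of \<open>j * T\<close>, and neither
  \<open>u\<close> nor the eigenfunction \<open>w\<close> sees such a shift. For \<open>u\<close>
  this is \<open>T\<close>-periodicity, so the equation and the coefficient matrices along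
  \<open>u\<close> stay the same. For \<open>w\<close>, iterating the multiplier relation
  (\<open>quasi_periodic_power\<close>) gives the factor \<open>\<mu> ^ j = 1\<close> over
  \<open>j\<close> periods, so \<open>w\<close> has period \<open>j * T\<close>. Hence the same
  \<open>w\<close> serves at the new delay. \<open>periodic_minus_of_int\<close> covers both signs
  of \<open>k\<close>.\<close>

lemma periodic_minus_of_int:
  fixes g :: "real \<Rightarrow> 'a" and P :: real
  assumes "\<And>t. g (t + P) = g t"
  shows "g (t - of_int k * P) = g t"
proof -
  interpret periodic_fun_simple g P
    by unfold_locales (rule assms)
  show ?thesis
    by (rule minus_of_int)
qed

lemma quasi_periodic_power:
  fixes w :: "real \<Rightarrow> 'a::comm_semiring_1 ^ 'n" and T :: real
  assumes "\<And>t. w (t + T) = \<mu> *s w t"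
  shows "w (t + real n * T) = \<mu> ^ n *s w t"
proof (induction n)
  case 0
  show ?case by simp
next
  case (Suc n)
  have "w (t + real (Suc n) * T) = w (t + real n * T + T)"
    by (simp add: algebra_simps)
  then show ?case
    by (simp add: assms Suc vector_smult_assoc)
qed

theorem lemma1:
  fixes f :: "(complex ^ 'd) \<times> (complex ^ 'd) \<Rightarrow> complex ^ 'd"
    and u :: "real \<Rightarrow> complex ^ 'd"
    and \<tau> T :: real
    and \<mu> :: complex
    and j :: nat
  assumes "smooth_rhs f"
    and "periodic_solution f \<tau> T u"
    and "floquet_multiplier f \<tau> T u \<mu>"
    and "j \<ge> 2"
    and "\<mu> ^ j = 1"
    and "\<forall>l\<in>{1..j - 1}. \<mu> ^ l \<noteq> 1"
  shows "\<forall>k :: int.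
           periodic_solution f (\<tau> + real j * real_of_int k * T) T u \<and>
           floquet_multiplier f (\<tau> + real j * real_of_int k * T) T u \<mu>"
proof
  fix k :: int
  let ?\<sigma> = "\<tau> + real j * real_of_int k * T"
  have T: "T > 0" and per: "\<And>t. u (t + T) = u t" and sol: "dde_solution f \<tau> u"
    using assms(2) by (auto simp: periodic_solution_def)
  have u_shift: "u (t - ?\<sigma>) = u (t - \<tau>)" for t
    \<comment> \<open>For \<open>u\<close> the added delay counts as \<open>j * k\<close> periods of
      length \<open>T\<close>.\<close>
    using periodic_minus_of_int[of u T "t - \<tau>" "int j * k", OF per]
    by (simp add: algebra_simps)
  have "periodic_solution f ?\<sigma> T u"
    using sol T per unfolding periodic_solution_def dde_solution_def u_shift by blast
  moreover have "floquet_multiplier f ?\<sigma> T u \<mu>"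
  proof -
    obtain w where w: "continuous_on UNIV w" "\<exists>t. w t \<noteq> 0"
        "\<forall>t. (w has_vector_derivative
          (partial_x f (u t, u (t - \<tau>)) *v w t +
           partial_y f (u t, u (t - \<tau>)) *v w (t - \<tau>))) (at t)"
        "\<forall>t. \<mu> *s w t = w (t + T)"
      using assms(3) unfolding floquet_multiplier_def Let_def by blast
    have "w (t + real j * T) = w t" for t
      using quasi_periodic_power[of w T \<mu> t j] w(4) assms(5) by simp
    \<comment> \<open>For \<open>w\<close> the same added delay counts as \<open>k\<close> periods
      of length \<open>j * T\<close>; \<open>T\<close> itself is not a period of \<open>w\<close>,
      since \<open>\<mu> \<noteq> 1\<close>.\<close>
    from periodic_minus_of_int[of w, OF this]
    have w_shift: "w (t - ?\<sigma>) = w (t - \<tau>)" for t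
      by (metis (no_types, opaque_lifting) diff_diff_eq mult.assoc mult.commute)
    show ?thesis
      \<comment> \<open>Rewriting with \<open>u_shift\<close> turns the coefficients at the new
        delay into those at \<open>\<tau>\<close>; only the delayed value of \<open>w\<close>
        remains to be compared.\<close>
      unfolding floquet_multiplier_def Let_def u_shift
      by (rule exI[of _ w]) (use w in \<open>simp add: w_shift\<close>)
  qed
  ultimately show "periodic_solution f ?\<sigma> T u \<and> floquet_multiplier f ?\<sigma> T u \<mu>" ..
qed

end
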